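(* (Dual formulation of the incremental problem for $\alpha \geq 2$.) Let $\alpha \geq 2$ be an integer and $\beta \in (1,2]$ with $1/\alpha + 1/\beta = 1$. Let $p \in [1,2]$ and $q \in [2,\infty]$ with $1/p+1/q=1$, let $z_1,\dots,z_n \in \mathbb{R}^{d+1}$ and $y \in \mathbb{R}^n$. Let $I_+ = \{i : y_i \geq 0\}$, $I_- = \{i : y_i < 0\}$, $t_i = |y_i|^{1/\alpha} z_i$, and let $T_+$ (resp. $T_-$) be the matrix with rows $t_i^\top$, $i \in I_+$ (resp. $i \in I_-$). Then $$\max_{\|v\|_p \leq 1} \frac{1}{\alpha} \sum_{i=1}^n y_i (v^\top z_i)_+^\alpha = \max_{b_+ \in \mathbb{R}_+^{I_+}} \ \min_{b_- \in \mathbb{R}_+^{I_-}} \ \big\| T_+^\top b_+ - T_-^\top b_- \big\|_q - \frac{1}{\beta}\|b_+\|_\beta^\beta + \frac{1}{\beta} \|b_-\|_\beta^\beta .$$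
   Context: $(u)_+^\alpha = \max\{u,0\}^\alpha$; $\mathbb{R}_+ = [0,\infty)$; $\|b\|_\beta^\beta = \sum_i |b_i|^\beta$. If $I_+$ (resp. $I_-$) is empty, the corresponding terms are $0$. *)

theory Defs
  imports "HOL-Analysis.Analysis"
begin

text \<open>The \<open>\<ell>\<^sub>r\<close> norm on coordinate vectors, for an exponent \<open>r\<close> in \<open>[1, \<infinity>]\<close>.\<close>

definition lnorm :: "ereal \<Rightarrow> real ^ 'd \<Rightarrow> real" where
  "lnorm r x =
     (if r = \<infinity> then Max (range (\<lambda>j. \<bar>x $ j\<bar>))
      else (\<Sum>j\<in>UNIV. \<bar>x $ j\<bar> powr real_of_ereal r) powr (1 / real_of_ereal r))"

definition idx_pos :: "nat \<Rightarrow> (nat \<Rightarrow> real) \<Rightarrow> nat set" where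
  "idx_pos n y = {i \<in> {1..n}. y i \<ge> 0}"

definition idx_neg :: "nat \<Rightarrow> (nat \<Rightarrow> real) \<Rightarrow> nat set" where
  "idx_neg n y = {i \<in> {1..n}. y i < 0}"

text \<open>\<open>\<real>\<^sub>+\<close> to the power \<open>I\<close>; extensionality makes elements with the same entries on \<open>I\<close> equal,
  and for empty \<open>I\<close> there is exactly one element.\<close>

definition nonneg_vecs :: "nat set \<Rightarrow> (nat \<Rightarrow> real) set" where
  "nonneg_vecs I = I \<rightarrow>\<^sub>E {0..}"

definition scaled_pts :: "nat \<Rightarrow> (nat \<Rightarrow> real) \<Rightarrow> (nat \<Rightarrow> real ^ 'd) \<Rightarrow> nat \<Rightarrow> real ^ 'd" where
  "scaled_pts \<alpha> y z i = (\<bar>y i\<bar> powr (1 / real \<alpha>)) *\<^sub>R z i"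

text \<open>The product of the transpose of the matrix with rows \<open>t i\<close>, \<open>i \<in> I\<close>, with the vector
  \<open>(b i)\<close>, \<open>i \<in> I\<close>.  The row set \<open>I\<close> depends on the data, so it cannot be a type index.\<close>

definition transpose_rows_mult ::
    "nat set \<Rightarrow> (nat \<Rightarrow> real ^ 'd) \<Rightarrow> (nat \<Rightarrow> real) \<Rightarrow> real ^ 'd" where
  "transpose_rows_mult I t b = (\<chi> j. \<Sum>i\<in>I. t i $ j * b i)"

definition norm_pow :: "real \<Rightarrow> nat set \<Rightarrow> (nat \<Rightarrow> real) \<Rightarrow> real" where
  "norm_pow \<beta> I b = (\<Sum>i\<in>I. \<bar>b i\<bar> powr \<beta>)"

definition primal_obj ::
    "nat \<Rightarrow> nat \<Rightarrow> (nat \<Rightarrow> real) \<Rightarrow> (nat \<Rightarrow> real ^ 'd) \<Rightarrow> real ^ 'd \<Rightarrow> real" where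
  "primal_obj \<alpha> n y z v = 1 / real \<alpha> * (\<Sum>i=1..n. y i * max (v \<bullet> z i) 0 ^ \<alpha>)"

definition dual_obj ::
    "nat \<Rightarrow> real \<Rightarrow> ereal \<Rightarrow> nat \<Rightarrow> (nat \<Rightarrow> real) \<Rightarrow> (nat \<Rightarrow> real ^ 'd) \<Rightarrow>
     (nat \<Rightarrow> real) \<Rightarrow> (nat \<Rightarrow> real) \<Rightarrow> real" where
  "dual_obj \<alpha> \<beta> q n y z bp bn =
     lnorm q (transpose_rows_mult (idx_pos n y) (scaled_pts \<alpha> y z) bp
              - transpose_rows_mult (idx_neg n y) (scaled_pts \<alpha> y z) bn)
     - 1 / \<beta> * norm_pow \<beta> (idx_pos n y) bp
     + 1 / \<beta> * norm_pow \<beta> (idx_neg n y) bn"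

text \<open>On the reals, \<open>Sup\<close> and \<open>Inf\<close> are unspecified for unbounded sets; the existence clauses below
  make them a genuine maximum and minimum.\<close>

definition attains_max :: "('a \<Rightarrow> real) \<Rightarrow> 'a set \<Rightarrow> bool" where
  "attains_max f S \<longleftrightarrow> (\<exists>x\<in>S. \<forall>x'\<in>S. f x' \<le> f x)"

definition attains_min :: "('a \<Rightarrow> real) \<Rightarrow> 'a set \<Rightarrow> bool" where
  "attains_min f S \<longleftrightarrow> (\<exists>x\<in>S. \<forall>x'\<in>S. f x \<le> f x')"

end

(*
  With b_i = (v . t_i)_+^(alpha-1), Young's inequality b u <= b^beta/beta + u_+^alpha/alpha (b >= 0)
  becomes an equality at u = v . t_i.  For fixed b_+ no minimax theorem is needed: the
  concave function h(v) = v . c - 1/alpha * sum_{i in I_-} (v . t_i)_+^alpha, c = T_+^T b_+, has a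
  maximiser v on the compact convex unit ball, and the gradient of h there is c - T_-^T b_- with
  b_- the vector of Young equality.  First-order optimality says that v maximises the linear form
  w . (c - T_-^T b_-), i.e. attains the dual norm, so (v, b_-) closes the duality gap.
  The outer maximisation is a plain exchange of two suprema, again through Young's inequality.
*)
theory Submission
  imports Defs
begin

section \<open>Unit balls of the norms with finite exponent\<close>

text \<open>The power is convex on the positive half-line; the triangle inequality and monotonicity
  of the power carry this over to absolute values, and points at 0 are treated separately.\<close>

lemma convex_on_abs_powr:
  fixes r :: real
  assumes "r \<ge> 1"
  shows "convex_on UNIV (\<lambda>x::real. \<bar>x\<bar> powr r)"
proof (rule convex_onI)
  fix t x y :: real
  assume t: "t > 0" "t < 1"
  \<comment> \<open>When one of the two points is 0, the convex combination is a single scaled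
    point, and \<open>s powr r \<le> s\<close> for \<open>0 < s < 1\<close> suffices.\<close>
  have scale: "(s * c) powr r \<le> s * c powr r" if "0 < s" "s < 1" "c \<ge> 0" for s c :: real
    using that assms powr_le_one_le[of s r] by (simp add: powr_mult mult_right_mono)
  have "((1 - t) * \<bar>x\<bar> + t * \<bar>y\<bar>) powr r \<le> (1 - t) * \<bar>x\<bar> powr r + t * \<bar>y\<bar> powr r"
  proof (cases "x = 0 \<or> y = 0")
    case True
    then show ?thesis
      using scale[of t "\<bar>y\<bar>"] scale[of "1 - t" "\<bar>x\<bar>"] t assms by auto
  next
    case False
    then show ?thesis
      using convex_onD[OF powr_convex[OF assms], of t "\<bar>x\<bar>" "\<bar>y\<bar>"] t by simp
  qed
  moreover have "\<bar>(1 - t) * x + t * y\<bar> \<le> (1 - t) * \<bar>x\<bar> + t * \<bar>y\<bar>"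
    using t abs_triangle_ineq[of "(1 - t) * x" "t * y"] by (simp add: abs_mult)
  ultimately show "\<bar>(1 - t) *\<^sub>R x + t *\<^sub>R y\<bar> powr r \<le> (1 - t) * \<bar>x\<bar> powr r + t * \<bar>y\<bar> powr r"
    using powr_mono2[of r "\<bar>(1 - t) * x + t * y\<bar>" "(1 - t) * \<bar>x\<bar> + t * \<bar>y\<bar>"] assms by simp
qed simp

lemma lnorm_ereal: "lnorm (ereal r) x = (\<Sum>j\<in>UNIV. \<bar>x $ j\<bar> powr r) powr (1 / r)"
  by (simp add: lnorm_def)

text \<open>Taking the r-th root is monotone and fixes 1. The unit ball thus becomes a sublevel set
  of a sum of coordinate functions, convex for \<open>r \<ge> 1\<close>, so its convexity follows
  coordinatewise instead of from Minkowski's inequality.\<close>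

lemma lnorm_le_1_iff:
  assumes "r > 0"
  shows "lnorm (ereal r) x \<le> 1 \<longleftrightarrow> (\<Sum>j\<in>UNIV. \<bar>x $ j\<bar> powr r) \<le> 1" (is "_ \<longleftrightarrow> ?S \<le> 1")
proof -
  have "?S \<ge> 0" by (intro sum_nonneg) simp
  moreover have "?S powr (1 / r) > 1" if "?S > 1"
    using powr_less_mono2[of "1 / r" 1 ?S] that assms by simp
  ultimately show ?thesis
    using powr_le1[of "1 / r" ?S] assms unfolding lnorm_ereal by (smt (verit) divide_nonneg_pos)
qed

lemma convex_unit_ball_lnorm:
  assumes "r \<ge> 1"
  shows "convex {v :: real ^ 'd. lnorm (ereal r) v \<le> 1}"
proof (rule convexI)
  fix x y :: "real ^ 'd" and u v :: real
  assume x: "x \<in> {v. lnorm (ereal r) v \<le> 1}" and y: "y \<in> {v. lnorm (ereal r) v \<le> 1}"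
    and uv: "0 \<le> u" "0 \<le> v" "u + v = 1"
  have "(\<Sum>j\<in>UNIV. \<bar>(u *\<^sub>R x + v *\<^sub>R y) $ j\<bar> powr r)
      \<le> (\<Sum>j\<in>UNIV. u * \<bar>x $ j\<bar> powr r + v * \<bar>y $ j\<bar> powr r)"
    using convex_on_abs_powr[OF assms] uv by (intro sum_mono) (simp add: convex_on_def)
  also have "\<dots> = u * (\<Sum>j\<in>UNIV. \<bar>x $ j\<bar> powr r) + v * (\<Sum>j\<in>UNIV. \<bar>y $ j\<bar> powr r)"
    by (simp add: sum.distrib sum_distrib_left)
  also have "\<dots> \<le> u * 1 + v * 1"
    using x y uv assms by (intro add_mono mult_left_mono) (auto simp: lnorm_le_1_iff)
  finally show "u *\<^sub>R x + v *\<^sub>R y \<in> {v. lnorm (ereal r) v \<le> 1}"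
    using uv assms by (simp add: lnorm_le_1_iff)
qed

lemma compact_unit_ball_lnorm:
  assumes "r > 0"
  shows "compact {v :: real ^ 'd. lnorm (ereal r) v \<le> 1}"
proof -
  have "continuous_on UNIV (\<lambda>v :: real ^ 'd. \<Sum>j\<in>UNIV. \<bar>v $ j\<bar> powr r)"
    using assms by (intro continuous_on_sum continuous_on_powr' continuous_on_rabs continuous_on_component
        continuous_on_const continuous_on_id) auto
  then have "closed {v :: real ^ 'd. (\<Sum>j\<in>UNIV. \<bar>v $ j\<bar> powr r) \<le> 1}"
    by (rule closed_Collect_le) (rule continuous_on_const)
  moreover have "bounded {v :: real ^ 'd. (\<Sum>j\<in>UNIV. \<bar>v $ j\<bar> powr r) \<le> 1}"
    unfolding bounded_iff
  proof (intro exI ballI)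
    fix v :: "real ^ 'd"
    assume v: "v \<in> {v. (\<Sum>j\<in>UNIV. \<bar>v $ j\<bar> powr r) \<le> 1}"
    \<comment> \<open>Coordinates bounded by 1 bound the l1 norm by the dimension, and the l1 norm
      dominates the Euclidean one.\<close>
    have "\<bar>v $ j\<bar> \<le> 1" for j
    proof (rule ccontr)
      assume "\<not> \<bar>v $ j\<bar> \<le> 1"
      then have "\<bar>v $ j\<bar> powr r > 1"
        using powr_less_mono2[of r 1 "\<bar>v $ j\<bar>"] assms by simp
      moreover have "\<bar>v $ j\<bar> powr r \<le> (\<Sum>j\<in>UNIV. \<bar>v $ j\<bar> powr r)"
        by (intro member_le_sum) auto
      ultimately show False using v by simp
    qed
    then have "(\<Sum>j\<in>UNIV. \<bar>v $ j\<bar>) \<le> (\<Sum>j\<in>(UNIV :: 'd set). 1)"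
      by (intro sum_mono)
    then show "norm v \<le> (\<Sum>j\<in>(UNIV :: 'd set). 1)"
      using norm_le_l1_cart[of v] by linarith
  qed
  ultimately show ?thesis
    using assms by (simp add: lnorm_le_1_iff compact_eq_bounded_closed)
qed

lemma zero_in_unit_ball_lnorm: "lnorm (ereal r) (0 :: real ^ 'd) \<le> 1"
  by (simp add: lnorm_ereal)

section \<open>Duality of the l_p and l_q norms\<close>

text \<open>Hoelder's inequality with its equality case. Normalising \<open>x\<close> by its q-norm
  \<open>s\<close> makes the coordinatewise Young inequalities add up to at most 1/p + 1/q = 1;
  \<open>x = 0\<close> is separated because then \<open>s = 0\<close>.\<close>

lemma lnorm_dual_finite:
  fixes x :: "real ^ 'd"
  assumes "p > 1" "q > 1" "1 / p + 1 / q = 1"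
  shows "\<And>v. lnorm (ereal p) v \<le> 1 \<Longrightarrow> v \<bullet> x \<le> lnorm (ereal q) x"
    and "\<exists>v. lnorm (ereal p) v \<le> 1 \<and> v \<bullet> x = lnorm (ereal q) x"
proof -
  define S where "S = (\<Sum>j\<in>UNIV. \<bar>x $ j\<bar> powr q)"
  define s where "s = lnorm (ereal q) x"
  have s: "s = S powr (1 / q)"
    by (simp add: s_def S_def lnorm_ereal)
  have S0: "S \<ge> 0"
    unfolding S_def by (intro sum_nonneg) simp
  have sS: "s powr q = S" and s0: "s \<ge> 0"
    using S0 assms by (auto simp: s powr_powr)
  have zero: "x = 0" if "S = 0"
  proof -
    have "\<forall>j\<in>UNIV. \<bar>x $ j\<bar> powr q = 0"
      using that unfolding S_def by (subst (asm) sum_nonneg_eq_0_iff) auto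
    then show ?thesis by (simp add: vec_eq_iff)
  qed
  have pos: "s > 0" if "S > 0"
    using that by (simp add: s)
  have norm1: "(\<Sum>j\<in>UNIV. (\<bar>x $ j\<bar> / s) powr q) = 1" if "S > 0"
    using that pos[OF that] sS
    by (simp add: powr_divide flip: sum_divide_distrib S_def)
  show "v \<bullet> x \<le> lnorm (ereal q) x" if v: "lnorm (ereal p) v \<le> 1" for v
  proof (cases "S = 0")
    case True
    then show ?thesis using zero s0 by (simp add: s_def)
  next
    case False
    then have S: "S > 0" using S0 by simp
    have "v \<bullet> x / s = (\<Sum>j\<in>UNIV. v $ j * (x $ j / s))"
      by (simp add: inner_vec_def sum_divide_distrib)
    also have "\<dots> \<le> (\<Sum>j\<in>UNIV. \<bar>v $ j\<bar> powr p / p + (\<bar>x $ j\<bar> / s) powr q / q)"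
    proof (rule sum_mono)
      fix j
      have "v $ j * (x $ j / s) \<le> \<bar>v $ j * (x $ j / s)\<bar>" by (rule abs_ge_self)
      also have "\<dots> = \<bar>v $ j\<bar> * (\<bar>x $ j\<bar> / s)"
        using pos[OF S] by (simp add: abs_mult)
      also have "\<dots> \<le> \<bar>v $ j\<bar> powr p / p + (\<bar>x $ j\<bar> / s) powr q / q"
        using assms pos[OF S] by (intro Youngs_inequality) auto
      finally show "v $ j * (x $ j / s) \<le> \<bar>v $ j\<bar> powr p / p + (\<bar>x $ j\<bar> / s) powr q / q" .
    qed
    also have "\<dots> = (\<Sum>j\<in>UNIV. \<bar>v $ j\<bar> powr p) / p + 1 / q"
      using norm1[OF S] by (simp add: sum.distrib flip: sum_divide_distrib)
    also have "\<dots> \<le> 1 / p + 1 / q"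
      using v assms by (intro add_mono divide_right_mono) (auto simp: lnorm_le_1_iff)
    finally show ?thesis
      using pos[OF S] assms by (simp add: s_def field_simps)
  qed
  show "\<exists>v. lnorm (ereal p) v \<le> 1 \<and> v \<bullet> x = lnorm (ereal q) x"
  proof (cases "S = 0")
    case True
    then show ?thesis
      using zero s zero_in_unit_ball_lnorm[of p] by (intro exI[of _ 0]) (simp add: s_def)
  next
    case False
    then have S: "S > 0" using S0 by simp
    \<comment> \<open>The equality case of Young: |v_j|^p = (|x_j|/s)^q because (q - 1) p = q, so
      these powers sum to 1, and v_j x_j = s (|x_j|/s)^q.\<close>
    define v :: "real ^ 'd" where "v = (\<chi> j. sgn (x $ j) * (\<bar>x $ j\<bar> / s) powr (q - 1))"
    have pq: "(q - 1) * p = q"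
      using assms by (simp add: field_simps)
    have "\<bar>v $ j\<bar> powr p = (\<bar>x $ j\<bar> / s) powr q" for j
      using pq by (simp add: v_def abs_mult sgn_if powr_powr)
    then have "lnorm (ereal p) v \<le> 1"
      using norm1[OF S] assms by (simp add: lnorm_le_1_iff)
    moreover have "v $ j * x $ j = s * (\<bar>x $ j\<bar> / s) powr q" for j
    proof (cases "x $ j = 0")
      case False
      have "(\<bar>x $ j\<bar> / s) powr q = (\<bar>x $ j\<bar> / s) powr (q - 1) * (\<bar>x $ j\<bar> / s)"
        using False pos[OF S] powr_add[of "\<bar>x $ j\<bar> / s" "q - 1" 1] by simp
      moreover have "sgn (x $ j) * x $ j = \<bar>x $ j\<bar>"
        by (simp add: abs_sgn mult.commute)
      ultimately show ?thesis
        using pos[OF S] by (simp add: v_def algebra_simps)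
    qed (simp add: v_def)
    then have "v \<bullet> x = s"
      using norm1[OF S] by (simp add: inner_vec_def flip: sum_distrib_left)
    ultimately show ?thesis by (auto simp: s_def)
  qed
qed

text \<open>The endpoint p = 1: the largest modulus of a coordinate of \<open>x\<close> is pulled
  out of the sum, and \<open>axis k (sgn (x $ k))\<close> at a coordinate \<open>k\<close> of
  largest modulus attains the bound.\<close>

lemma lnorm_dual_infinity:
  fixes x :: "real ^ 'd"
  shows "\<And>v. lnorm (ereal 1) v \<le> 1 \<Longrightarrow> v \<bullet> x \<le> lnorm \<infinity> x"
    and "\<exists>v. lnorm (ereal 1) v \<le> 1 \<and> v \<bullet> x = lnorm \<infinity> x"
proof -
  have m: "\<bar>x $ j\<bar> \<le> lnorm \<infinity> x" for j
    by (simp add: lnorm_def)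
  show "v \<bullet> x \<le> lnorm \<infinity> x" if v: "lnorm (ereal 1) v \<le> 1" for v
  proof -
    have "v \<bullet> x \<le> (\<Sum>j\<in>UNIV. \<bar>v $ j\<bar> * lnorm \<infinity> x)"
      unfolding inner_vec_def
    proof (rule sum_mono)
      fix j
      have "v $ j * x $ j \<le> \<bar>v $ j\<bar> * \<bar>x $ j\<bar>"
        by (metis abs_ge_self abs_mult)
      also have "\<dots> \<le> \<bar>v $ j\<bar> * lnorm \<infinity> x"
        using m by (intro mult_left_mono) auto
      finally show "v $ j \<bullet> x $ j \<le> \<bar>v $ j\<bar> * lnorm \<infinity> x" by simp
    qed
    also have "\<dots> = (\<Sum>j\<in>UNIV. \<bar>v $ j\<bar>) * lnorm \<infinity> x"
      by (simp add: sum_distrib_right)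
    \<comment> \<open>An arbitrary coordinate, via \<open>m[of undefined]\<close>, shows that the
      max norm is nonnegative.\<close>
    also have "\<dots> \<le> 1 * lnorm \<infinity> x"
      using v m[of undefined] by (intro mult_right_mono) (auto simp: lnorm_le_1_iff)
    finally show ?thesis by simp
  qed
  have "lnorm \<infinity> x \<in> range (\<lambda>j. \<bar>x $ j\<bar>)"
    unfolding lnorm_def by (simp only: if_True simp_thms refl) (rule Max_in, auto)
  then obtain k where k: "lnorm \<infinity> x = \<bar>x $ k\<bar>" by auto
  have "lnorm (ereal 1) (axis k (sgn (x $ k))) \<le> 1"
    by (simp add: lnorm_le_1_iff axis_def if_distrib[of abs] sgn_if cong: if_cong)
  moreover have "axis k (sgn (x $ k)) \<bullet> x = lnorm \<infinity> x"
    by (simp add: k inner_axis' abs_sgn mult.commute)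
  ultimately show "\<exists>v. lnorm (ereal 1) v \<le> 1 \<and> v \<bullet> x = lnorm \<infinity> x" by blast
qed

text \<open>\<open>p \<le> 2\<close> makes \<open>p\<close> finite. If \<open>q\<close> is finite,
  1/q > 0 excludes p = 1; if \<open>q = \<infinity>\<close>, then 1/q = 0 forces p = 1. The
  alternatives match the two norm duality lemmas.\<close>

lemma conjugate_exponents_cases:
  fixes p q :: ereal
  assumes "1 \<le> p" "p \<le> 2" "2 \<le> q" "1 / p + 1 / q = 1"
  obtains "p = ereal 1" "q = \<infinity>"
  | p' q' where "p = ereal p'" "q = ereal q'" "p' > 1" "q' > 1" "1 / p' + 1 / q' = 1"
proof -
  obtain p' where p: "p = ereal p'" using assms by (cases p) auto
  show ?thesis
  proof (cases q)
    case (real q')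
    have "p' \<ge> 1" "q' \<ge> 2" using assms p real by (auto simp: one_ereal_def)
    moreover have eq: "1 / p' + 1 / q' = 1"
      using assms(4) p real \<open>p' \<ge> 1\<close> \<open>q' \<ge> 2\<close> by (simp add: one_ereal_def)
    moreover have "p' \<noteq> 1" using eq \<open>q' \<ge> 2\<close> by auto
    ultimately show ?thesis using that(2) p real by force
  next
    case PInf
    have "p' \<ge> 1" using assms p by (auto simp: one_ereal_def)
    then have "1 / p' = 1"
      using assms(4) p PInf by (simp add: one_ereal_def)
    then show ?thesis using that(1) p PInf by (simp add: field_simps)
  qed (use assms in auto)
qed

section \<open>Young's inequality for powers of the positive part\<close>

lemma inner_transpose_rows_mult:
  "v \<bullet> transpose_rows_mult I t b = (\<Sum>i\<in>I. b i * (v \<bullet> t i))"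
proof -
  have "v \<bullet> transpose_rows_mult I t b = (\<Sum>j\<in>UNIV. \<Sum>i\<in>I. b i * (v $ j * t i $ j))"
    by (simp add: transpose_rows_mult_def inner_vec_def sum_distrib_left algebra_simps)
  also have "\<dots> = (\<Sum>i\<in>I. b i * (v \<bullet> t i))"
    by (subst sum.swap) (simp add: inner_vec_def sum_distrib_left)
  finally show ?thesis .
qed

text \<open>The sign constraint on \<open>b\<close> lets \<open>max u 0\<close> replace
  \<open>u\<close> at the cost of increasing the left side, after which the classical inequality for
  nonnegative numbers applies.\<close>

lemma young_pos_part_le:
  fixes b u :: real
  assumes "\<alpha> \<ge> 2" "\<beta> > 1" "1 / real \<alpha> + 1 / \<beta> = 1" "b \<ge> 0"
  shows "b * u \<le> max u 0 ^ \<alpha> / real \<alpha> + \<bar>b\<bar> powr \<beta> / \<beta>"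
proof -
  have "b * u \<le> max u 0 * b"
    using assms by (simp add: mult.commute mult_left_mono)
  also have "\<dots> \<le> max u 0 powr real \<alpha> / real \<alpha> + b powr \<beta> / \<beta>"
    using assms by (intro Youngs_inequality) auto
  also have "max u 0 powr real \<alpha> = max u 0 ^ \<alpha>"
    using assms by (cases "max u 0 = 0") (simp_all add: powr_realpow del: max.absorb1 max.absorb2)
  finally show ?thesis using assms by simp
qed

text \<open>For \<open>u > 0\<close>, (\<alpha> - 1) \<beta> = \<alpha> gives
  \<open>b powr \<beta> = u ^ \<alpha>\<close>, so by conjugacy both sides equal
  \<open>u ^ \<alpha>\<close>. This \<open>b\<close> supplies the dual vectors below.\<close>

lemma young_pos_part_eq:
  fixes u :: real
  assumes "\<alpha> \<ge> 2" "\<beta> > 1" "1 / real \<alpha> + 1 / \<beta> = 1"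
  defines "b \<equiv> max u 0 ^ (\<alpha> - 1)"
  shows "b * u = max u 0 ^ \<alpha> / real \<alpha> + \<bar>b\<bar> powr \<beta> / \<beta>"
proof (cases "u > 0")
  case True
  have e: "real (\<alpha> - 1) * \<beta> = real \<alpha>"
    using assms by (simp add: field_simps of_nat_diff)
  have "b powr \<beta> = (u powr real (\<alpha> - 1)) powr \<beta>"
    using True by (simp add: b_def powr_realpow)
  also have "\<dots> = u ^ \<alpha>"
    using True unfolding powr_powr e by (rule powr_realpow)
  finally have "b powr \<beta> = u ^ \<alpha>" .
  moreover have "b * u = u ^ \<alpha>"
    using True assms by (simp add: b_def flip: power_Suc2)
  moreover have "u ^ \<alpha> / real \<alpha> + u ^ \<alpha> / \<beta> = u ^ \<alpha> * (1 / real \<alpha> + 1 / \<beta>)"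
    by (simp only: distrib_left) simp
  ultimately show ?thesis
    using True assms(3) by (simp add: b_def)
next
  \<comment> \<open>Here \<open>b = 0 ^ (\<alpha> - 1)\<close>, which vanishes because
    \<open>\<alpha> \<ge> 2\<close>; at \<alpha> = 1 it would be 1.\<close>
  case False
  then show ?thesis using assms by (simp add: b_def power_0_left)
qed

section \<open>First-order optimality\<close>

text \<open>Away from 0 the function agrees locally with \<open>u ^ \<alpha>\<close> or with 0. At
  the kink the difference quotient is \<open>max h 0 ^ (\<alpha> - 1)\<close>, which tends to 0
  because \<open>\<alpha> \<ge> 2\<close>.\<close>

lemma DERIV_pos_part_power:
  fixes x :: real
  assumes "\<alpha> \<ge> 2"
  shows "((\<lambda>u. max u 0 ^ \<alpha>) has_real_derivative real \<alpha> * max x 0 ^ (\<alpha> - 1)) (at x)"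
proof -
  consider "x > 0" | "x < 0" | "x = 0" by linarith
  then show ?thesis
  proof cases
    case 1
    have "((\<lambda>u. u ^ \<alpha>) has_real_derivative real \<alpha> * max x 0 ^ (\<alpha> - 1)) (at x)"
      using 1 by (auto intro!: derivative_eq_intros)
    then show ?thesis
      by (rule has_field_derivative_transform_within_open[of _ _ _ "{0<..}"]) (use 1 in auto)
  next
    case 2
    have "((\<lambda>u. 0) has_real_derivative real \<alpha> * max x 0 ^ (\<alpha> - 1)) (at x)"
      using 2 assms by (auto simp: power_0_left)
    then show ?thesis
      by (rule has_field_derivative_transform_within_open[of _ _ _ "{..<0}"])
        (use 2 assms in \<open>auto simp: power_0_left\<close>)
  next
    case 3
    have "((\<lambda>h::real. max h 0 ^ (\<alpha> - 1)) \<longlongrightarrow> max 0 0 ^ (\<alpha> - 1)) (at 0)"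
      by (intro tendsto_intros)
    moreover have "max h 0 ^ (\<alpha> - 1) = max h 0 ^ \<alpha> / h" if "h \<noteq> 0" for h :: real
      using that assms
      by (cases "h > 0") (auto simp: power_0_left field_simps max_def simp flip: power_Suc)
    then have "\<forall>\<^sub>F h in at (0::real). max h 0 ^ (\<alpha> - 1) = max h 0 ^ \<alpha> / h"
      unfolding eventually_at_filter by (intro always_eventually allI impI)
    ultimately have "((\<lambda>h::real. max h 0 ^ \<alpha> / h) \<longlongrightarrow> max 0 0 ^ (\<alpha> - 1)) (at 0)"
      by (rule Lim_transform_eventually)
    then show ?thesis
      using 3 assms by (simp add: has_field_derivative_iff power_0_left)
  qed
qed

text \<open>Along the segment from \<open>v\<close> to \<open>w\<close>, which convexity keeps
  inside \<open>K\<close>, the objective never exceeds its value at \<open>v\<close>, so its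
  derivative in direction \<open>w - v\<close> is at most 0. The vector paired with \<open>v\<close>
  and \<open>w\<close> is the gradient at \<open>v\<close>.\<close>

lemma pos_part_sum_first_order:
  fixes c :: "real ^ 'd" and t :: "nat \<Rightarrow> real ^ 'd"
  assumes "\<alpha> \<ge> 2" "convex K" "v \<in> K" "w \<in> K"
    and max: "\<And>w. w \<in> K \<Longrightarrow> w \<bullet> c - (\<Sum>i\<in>J. max (w \<bullet> t i) 0 ^ \<alpha>) / real \<alpha>
                         \<le> v \<bullet> c - (\<Sum>i\<in>J. max (v \<bullet> t i) 0 ^ \<alpha>) / real \<alpha>"
  shows "w \<bullet> (c - transpose_rows_mult J t (\<lambda>i. max (v \<bullet> t i) 0 ^ (\<alpha> - 1)))
       \<le> v \<bullet> (c - transpose_rows_mult J t (\<lambda>i. max (v \<bullet> t i) 0 ^ (\<alpha> - 1)))"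
proof -
  define h where "h w = w \<bullet> c - (\<Sum>i\<in>J. max (w \<bullet> t i) 0 ^ \<alpha>) / real \<alpha>" for w
  define g where "g = c - transpose_rows_mult J t (\<lambda>i. max (v \<bullet> t i) 0 ^ (\<alpha> - 1))"
  define \<phi> where "\<phi> s = h (v + s *\<^sub>R (w - v))" for s
  have deriv: "((\<lambda>s. max ((v + s *\<^sub>R (w - v)) \<bullet> t i) 0 ^ \<alpha>) has_real_derivative
          real \<alpha> * max (v \<bullet> t i) 0 ^ (\<alpha> - 1) * ((w - v) \<bullet> t i)) (at 0)" for i
  proof -
    have "((\<lambda>s. (v + s *\<^sub>R (w - v)) \<bullet> t i) has_real_derivative (w - v) \<bullet> t i) (at 0)"
      by (auto intro!: derivative_eq_intros simp: inner_add_left)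
    from DERIV_chain2[OF DERIV_pos_part_power[OF assms(1)] this] show ?thesis by simp
  qed
  have "((\<lambda>s. (v + s *\<^sub>R (w - v)) \<bullet> c) has_real_derivative (w - v) \<bullet> c) (at 0)"
    by (auto intro!: derivative_eq_intros simp: inner_add_left)
  then have "(\<phi> has_real_derivative (w - v) \<bullet> c
      - (\<Sum>i\<in>J. real \<alpha> * max (v \<bullet> t i) 0 ^ (\<alpha> - 1) * ((w - v) \<bullet> t i)) / real \<alpha>) (at 0)"
    unfolding \<phi>_def h_def by (intro DERIV_diff DERIV_cdivide DERIV_sum deriv)
  also have "(w - v) \<bullet> c
      - (\<Sum>i\<in>J. real \<alpha> * max (v \<bullet> t i) 0 ^ (\<alpha> - 1) * ((w - v) \<bullet> t i)) / real \<alpha> = (w - v) \<bullet> g"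
    using assms(1)
    by (simp add: g_def inner_diff_right[of "w - v"] inner_transpose_rows_mult sum_divide_distrib)
  finally have der: "(\<phi> has_real_derivative (w - v) \<bullet> g) (at 0)" .
  have "(w - v) \<bullet> g \<le> 0"
  proof (rule ccontr)
    assume "\<not> (w - v) \<bullet> g \<le> 0"
    with DERIV_pos_inc_right[OF der] obtain d where
      d: "d > 0" "\<And>s. s > 0 \<Longrightarrow> s < d \<Longrightarrow> \<phi> 0 < \<phi> (0 + s)" by force
    \<comment> \<open>Halving \<open>d\<close> keeps \<open>s\<close> in the range of strict
      increase; the cap 1 keeps the point on the segment.\<close>
    define s where "s = min (d / 2) 1"
    have s: "0 < s" "s < d" "s \<le> 1" using d(1) by (auto simp: s_def)
    have "v + s *\<^sub>R (w - v) = (1 - s) *\<^sub>R v + s *\<^sub>R w"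
      by (simp add: algebra_simps)
    then have "v + s *\<^sub>R (w - v) \<in> K"
      using convexD_alt[OF assms(2-4)] s by simp
    then have "\<phi> s \<le> \<phi> 0"
      using max by (simp add: \<phi>_def h_def)
    with d(2)[of s] s show False by simp
  qed
  then show ?thesis by (simp add: g_def inner_diff_left)
qed

section \<open>The inner minimisation\<close>

text \<open>\<open>le\<close> and \<open>att\<close> say that \<open>N\<close> is the support
  function of \<open>K\<close>. The conclusion exposes the maximiser \<open>v\<close> along with the
  minimiser \<open>b\<close>, because the outer maximisation compares \<open>v\<close> with other
  points of \<open>K\<close>.\<close>

lemma partial_dual:
  fixes c :: "real ^ 'd" and t :: "nat \<Rightarrow> real ^ 'd"
  assumes exps: "\<alpha> \<ge> 2" "\<beta> > 1" "1 / real \<alpha> + 1 / \<beta> = 1"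
    and K: "convex K" "compact K" "K \<noteq> {}"
    and le: "\<And>v x. v \<in> K \<Longrightarrow> v \<bullet> x \<le> N x"
    and att: "\<And>x. \<exists>v\<in>K. v \<bullet> x = N x"
    and "finite J"
  shows "\<exists>v\<in>K. \<exists>b\<in>nonneg_vecs J.
     (\<forall>w\<in>K. w \<bullet> c - (\<Sum>i\<in>J. max (w \<bullet> t i) 0 ^ \<alpha>) / real \<alpha>
           \<le> v \<bullet> c - (\<Sum>i\<in>J. max (v \<bullet> t i) 0 ^ \<alpha>) / real \<alpha>)
     \<and> N (c - transpose_rows_mult J t b) + norm_pow \<beta> J b / \<beta>
         = v \<bullet> c - (\<Sum>i\<in>J. max (v \<bullet> t i) 0 ^ \<alpha>) / real \<alpha>
     \<and> (\<forall>b'\<in>nonneg_vecs J. v \<bullet> c - (\<Sum>i\<in>J. max (v \<bullet> t i) 0 ^ \<alpha>) / real \<alpha>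
           \<le> N (c - transpose_rows_mult J t b') + norm_pow \<beta> J b' / \<beta>)"
proof -
  define h where "h w = w \<bullet> c - (\<Sum>i\<in>J. max (w \<bullet> t i) 0 ^ \<alpha>) / real \<alpha>" for w
  have "continuous_on K h"
    unfolding h_def using exps by (intro continuous_intros) auto
  then obtain v where v: "v \<in> K" "\<And>w. w \<in> K \<Longrightarrow> h w \<le> h v"
    using continuous_attains_sup[OF K(2,3)] by blast
  \<comment> \<open>\<open>restrict\<close> supplies the extensionality that
    \<open>nonneg_vecs\<close> demands.\<close>
  define b where "b = restrict (\<lambda>i. max (v \<bullet> t i) 0 ^ (\<alpha> - 1)) J"
  have b: "b \<in> nonneg_vecs J"
    by (auto simp: b_def nonneg_vecs_def)
  have Tb: "transpose_rows_mult J t b = transpose_rows_mult J t (\<lambda>i. max (v \<bullet> t i) 0 ^ (\<alpha> - 1))"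
    by (simp add: transpose_rows_mult_def b_def)
  obtain w where w: "w \<in> K" "w \<bullet> (c - transpose_rows_mult J t b) = N (c - transpose_rows_mult J t b)"
    using att by blast
  \<comment> \<open>\<open>w\<close> attains the support function at the residual, and first-order
    optimality puts \<open>v\<close> at least as high, so \<open>v\<close> attains it too.\<close>
  have "w \<bullet> (c - transpose_rows_mult J t b) \<le> v \<bullet> (c - transpose_rows_mult J t b)"
    using pos_part_sum_first_order[OF exps(1) K(1) v(1) w(1)] v(2) unfolding Tb h_def by blast
  then have N: "N (c - transpose_rows_mult J t b) = v \<bullet> (c - transpose_rows_mult J t b)"
    using le[OF v(1)] w(2) by (simp add: order_antisym)
  \<comment> \<open>Summed Young equalities replace the pairing of \<open>b\<close> with the rows,
    so the dual value at \<open>b\<close> collapses to \<open>h v\<close>.\<close>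
  have "(\<Sum>i\<in>J. b i * (v \<bullet> t i)) = (\<Sum>i\<in>J. max (v \<bullet> t i) 0 ^ \<alpha> / real \<alpha> + \<bar>b i\<bar> powr \<beta> / \<beta>)"
    using young_pos_part_eq[OF exps] by (intro sum.cong) (simp_all add: b_def)
  then have eq: "N (c - transpose_rows_mult J t b) + norm_pow \<beta> J b / \<beta> = h v"
    unfolding N h_def norm_pow_def
    by (simp add: inner_diff_right inner_transpose_rows_mult sum.distrib sum_divide_distrib)
  \<comment> \<open>Weak duality: \<open>N\<close> is bounded below by the linear form at
    \<open>v\<close>, then Young's inequality applies to each row.\<close>
  have "h v \<le> N (c - transpose_rows_mult J t b') + norm_pow \<beta> J b' / \<beta>"
    if b': "b' \<in> nonneg_vecs J" for b'
  proof -
    have "(\<Sum>i\<in>J. b' i * (v \<bullet> t i))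
        \<le> (\<Sum>i\<in>J. max (v \<bullet> t i) 0 ^ \<alpha> / real \<alpha> + \<bar>b' i\<bar> powr \<beta> / \<beta>)"
      using b' by (intro sum_mono young_pos_part_le[OF exps]) (auto simp: nonneg_vecs_def)
    then show ?thesis
      using le[OF v(1), of "c - transpose_rows_mult J t b'"] unfolding h_def norm_pow_def
      by (simp add: inner_diff_right inner_transpose_rows_mult sum.distrib sum_divide_distrib)
  qed
  with v b eq show ?thesis unfolding h_def by blast
qed

section \<open>Splitting the primal objective by sign\<close>

text \<open>The nonnegative factor |y_i|^(1/\<alpha>) passes through the positive part and its
  \<alpha>-th power is |y_i|; the sign of y_i then decides which sum receives the term.\<close>

lemma primal_obj_split:
  fixes z :: "nat \<Rightarrow> real ^ 'd" and y :: "nat \<Rightarrow> real"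
  assumes "\<alpha> \<ge> 1"
  defines "t \<equiv> scaled_pts \<alpha> y z"
  shows "primal_obj \<alpha> n y z v = (\<Sum>i\<in>idx_pos n y. max (v \<bullet> t i) 0 ^ \<alpha>) / real \<alpha>
                              - (\<Sum>i\<in>idx_neg n y. max (v \<bullet> t i) 0 ^ \<alpha>) / real \<alpha>"
proof -
  have scaled: "max (v \<bullet> t i) 0 ^ \<alpha> = \<bar>y i\<bar> * max (v \<bullet> z i) 0 ^ \<alpha>" for i
  proof -
    define a where "a = \<bar>y i\<bar> powr (1 / real \<alpha>)"
    have "a ^ \<alpha> = \<bar>y i\<bar>"
    proof (cases "y i = 0")
      case False
      then have "a ^ \<alpha> = a powr real \<alpha>" by (simp add: a_def powr_realpow)
      then show ?thesis using assms by (simp add: a_def powr_powr)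
    qed (use assms in \<open>simp add: a_def power_0_left\<close>)
    moreover have "max (v \<bullet> t i) 0 = a * max (v \<bullet> z i) 0"
      by (simp add: t_def scaled_pts_def a_def max_mult_distrib_left)
    ultimately show ?thesis by (simp add: power_mult_distrib)
  qed
  have "{1..n} = idx_pos n y \<union> idx_neg n y" "idx_pos n y \<inter> idx_neg n y = {}"
    "finite (idx_pos n y)" "finite (idx_neg n y)"
    by (auto simp: idx_pos_def idx_neg_def)
  then have "(\<Sum>i=1..n. y i * max (v \<bullet> z i) 0 ^ \<alpha>)
      = (\<Sum>i\<in>idx_pos n y. y i * max (v \<bullet> z i) 0 ^ \<alpha>) + (\<Sum>i\<in>idx_neg n y. y i * max (v \<bullet> z i) 0 ^ \<alpha>)"
    by (simp add: sum.union_disjoint)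
  also have "(\<Sum>i\<in>idx_pos n y. y i * max (v \<bullet> z i) 0 ^ \<alpha>) = (\<Sum>i\<in>idx_pos n y. max (v \<bullet> t i) 0 ^ \<alpha>)"
    by (intro sum.cong) (auto simp: scaled idx_pos_def)
  also have "(\<Sum>i\<in>idx_neg n y. y i * max (v \<bullet> z i) 0 ^ \<alpha>) = - (\<Sum>i\<in>idx_neg n y. max (v \<bullet> t i) 0 ^ \<alpha>)"
    unfolding sum_negf[symmetric] by (intro sum.cong) (auto simp: scaled idx_neg_def)
  finally show ?thesis by (simp add: primal_obj_def diff_divide_distrib)
qed

section \<open>The outer maximisation and the duality theorem\<close>

lemma attains_max_SUP:
  assumes "x \<in> S" "\<And>x'. x' \<in> S \<Longrightarrow> f x' \<le> f x"
  shows "attains_max f S" "(SUP x\<in>S. f x) = (f x :: real)"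
  using assms by (auto simp: attains_max_def intro!: cSup_eq_maximum)

lemma attains_min_INF:
  assumes "x \<in> S" "\<And>x'. x' \<in> S \<Longrightarrow> f x \<le> f x'"
  shows "attains_min f S" "(INF x\<in>S. f x) = (f x :: real)"
  using assms by (auto simp: attains_min_def intro!: cInf_eq_minimum)

theorem mainTheorem13:
  fixes \<alpha> n :: nat and \<beta> :: real and p q :: ereal
    and z :: "nat \<Rightarrow> real ^ 'd" and y :: "nat \<Rightarrow> real"
  assumes "\<alpha> \<ge> 2" and "1 < \<beta>" and "\<beta> \<le> 2" and "1 / real \<alpha> + 1 / \<beta> = 1"
    and "1 \<le> p" and "p \<le> 2" and "2 \<le> q" and "1 / p + 1 / q = 1"
  shows "attains_max (primal_obj \<alpha> n y z) {v. lnorm p v \<le> 1}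
    \<and> (\<forall>bp \<in> nonneg_vecs (idx_pos n y).
         attains_min (\<lambda>bn. dual_obj \<alpha> \<beta> q n y z bp bn) (nonneg_vecs (idx_neg n y)))
    \<and> attains_max
         (\<lambda>bp. INF bn \<in> nonneg_vecs (idx_neg n y). dual_obj \<alpha> \<beta> q n y z bp bn)
         (nonneg_vecs (idx_pos n y))
    \<and> (SUP v \<in> {v. lnorm p v \<le> 1}. primal_obj \<alpha> n y z v)
      = (SUP bp \<in> nonneg_vecs (idx_pos n y).
           INF bn \<in> nonneg_vecs (idx_neg n y). dual_obj \<alpha> \<beta> q n y z bp bn)"
proof -
  define K where "K = {v :: real ^ 'd. lnorm p v \<le> 1}"
  define t where "t = scaled_pts \<alpha> y z"
  define I where "I = idx_pos n y"
  define J where "J = idx_neg n y"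
  define F where "F = primal_obj \<alpha> n y z"
  define D where "D = dual_obj \<alpha> \<beta> q n y z"
  define G where "G bp = (INF bn\<in>nonneg_vecs J. D bp bn)" for bp
  \<comment> \<open>The concave objective of the inner problem; \<open>G bp\<close> will be its
    maximum over \<open>K\<close> minus the penalty on \<open>bp\<close>.\<close>
  define h where "h bp w = w \<bullet> transpose_rows_mult I t bp
    - (\<Sum>i\<in>J. max (w \<bullet> t i) 0 ^ \<alpha>) / real \<alpha>" for bp w
  note exps = assms(1,2,4)
  have J: "finite J" by (simp add: J_def idx_neg_def)
  \<comment> \<open>Since \<open>p\<close> is real, the ball lemmas for finite exponents also cover
    the case \<open>q = \<infinity>\<close>.\<close>
  obtain p' where p': "p = ereal p'" "p' \<ge> 1"
    using assms(5,6) by (cases p) (auto simp: one_ereal_def)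
  have "0 \<in> K"
    using zero_in_unit_ball_lnorm by (simp add: K_def p')
  then have K: "convex K" "compact K" "K \<noteq> {}"
    using convex_unit_ball_lnorm[of p'] compact_unit_ball_lnorm[of p'] p' by (auto simp: K_def)
  have le: "v \<bullet> x \<le> lnorm q x" if "v \<in> K" for v x
  proof (cases rule: conjugate_exponents_cases[OF assms(5-8)])
    case 1
    then show ?thesis using lnorm_dual_infinity(1) that by (auto simp: K_def)
  next
    case (2 p' q')
    then show ?thesis using lnorm_dual_finite(1)[of p' q'] that by (auto simp: K_def)
  qed
  have att: "\<exists>v\<in>K. v \<bullet> x = lnorm q x" for x
  proof (cases rule: conjugate_exponents_cases[OF assms(5-8)])
    case 1
    then show ?thesis using lnorm_dual_infinity(2) by (auto simp: K_def)
  next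
    case (2 p' q')
    then show ?thesis using lnorm_dual_finite(2)[of p' q'] by (auto simp: K_def)
  qed
  have F: "F v = (\<Sum>i\<in>I. max (v \<bullet> t i) 0 ^ \<alpha>) / real \<alpha> - (\<Sum>i\<in>J. max (v \<bullet> t i) 0 ^ \<alpha>) / real \<alpha>" for v
    using primal_obj_split[of \<alpha>] assms(1) by (simp add: F_def I_def J_def t_def)
  have D: "D bp bn = lnorm q (transpose_rows_mult I t bp - transpose_rows_mult J t bn)
      + norm_pow \<beta> J bn / \<beta> - norm_pow \<beta> I bp / \<beta>" for bp bn
    by (simp add: D_def dual_obj_def I_def J_def t_def)
  \<comment> \<open>The penalty on \<open>bp\<close> is constant in \<open>bn\<close>, so it merely
    shifts the values given by \<open>partial_dual\<close>.\<close>
  have inner: "attains_min (D bp) (nonneg_vecs J) \<and>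
      (\<exists>v\<in>K. G bp = h bp v - norm_pow \<beta> I bp / \<beta> \<and> (\<forall>w\<in>K. h bp w \<le> h bp v))" for bp
  proof -
    obtain v b where v: "v \<in> K" "\<And>w. w \<in> K \<Longrightarrow> h bp w \<le> h bp v"
      and b: "b \<in> nonneg_vecs J"
      and eq: "D bp b = h bp v - norm_pow \<beta> I bp / \<beta>"
      and min: "\<And>b'. b' \<in> nonneg_vecs J \<Longrightarrow> h bp v - norm_pow \<beta> I bp / \<beta> \<le> D bp b'"
      using partial_dual[OF exps K le att J, of "transpose_rows_mult I t bp" t]
      unfolding h_def D by force
    then have "attains_min (D bp) (nonneg_vecs J)" "G bp = D bp b"
      unfolding G_def using attains_min_INF[of b "nonneg_vecs J" "D bp"] by auto
    then show ?thesis using v eq by auto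
  qed
  have "continuous_on K F"
    unfolding F using exps by (intro continuous_intros) auto
  then obtain v where v: "v \<in> K" "\<And>w. w \<in> K \<Longrightarrow> F w \<le> F v"
    using continuous_attains_sup[OF K(2,3)] by blast
  \<comment> \<open>With \<open>w\<close> the maximiser belonging to \<open>bp\<close>, Young's
    inequality exchanges the linear term in \<open>bp\<close> for the \<open>I\<close> part of
    \<open>F\<close>, so \<open>G bp \<le> F w\<close>.\<close>
  have G_le: "G bp \<le> F v" if bp: "bp \<in> nonneg_vecs I" for bp
  proof -
    obtain w where w: "w \<in> K" "G bp = h bp w - norm_pow \<beta> I bp / \<beta>"
      using inner by blast
    have "(\<Sum>i\<in>I. bp i * (w \<bullet> t i)) \<le> (\<Sum>i\<in>I. max (w \<bullet> t i) 0 ^ \<alpha> / real \<alpha> + \<bar>bp i\<bar> powr \<beta> / \<beta>)"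
      using bp by (intro sum_mono young_pos_part_le[OF exps]) (auto simp: nonneg_vecs_def)
    then have "G bp \<le> F w"
      unfolding w F h_def norm_pow_def
      by (simp add: inner_transpose_rows_mult sum.distrib sum_divide_distrib)
    also have "\<dots> \<le> F v" by (rule v(2)[OF w(1)])
    finally show ?thesis .
  qed
  \<comment> \<open>Young equality at the primal maximiser \<open>v\<close>: for this
    \<open>b\<close> the primal value is \<open>h b v\<close> minus the penalty, hence at most
    \<open>G b\<close>.\<close>
  define b where "b = restrict (\<lambda>i. max (v \<bullet> t i) 0 ^ (\<alpha> - 1)) I"
  have b: "b \<in> nonneg_vecs I"
    by (auto simp: b_def nonneg_vecs_def)
  have "(\<Sum>i\<in>I. b i * (v \<bullet> t i)) = (\<Sum>i\<in>I. max (v \<bullet> t i) 0 ^ \<alpha> / real \<alpha> + \<bar>b i\<bar> powr \<beta> / \<beta>)"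
    using young_pos_part_eq[OF exps] by (intro sum.cong) (simp_all add: b_def)
  then have "F v = h b v - norm_pow \<beta> I b / \<beta>"
    unfolding F h_def norm_pow_def
    by (simp add: inner_transpose_rows_mult sum.distrib sum_divide_distrib)
  also have "\<dots> \<le> G b"
    using inner[of b] v(1) by auto
  finally have Gb: "G b = F v"
    using G_le[OF b] by simp
  have "attains_max F K \<and> (\<forall>bp\<in>nonneg_vecs I. attains_min (D bp) (nonneg_vecs J))
      \<and> attains_max G (nonneg_vecs I) \<and> (SUP v\<in>K. F v) = (SUP bp\<in>nonneg_vecs I. G bp)"
    using attains_max_SUP[of v K F] attains_max_SUP[of b "nonneg_vecs I" G] v b G_le Gb inner
    by auto
  then show ?thesis
    unfolding K_def F_def G_def D_def I_def J_def .
qed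

end
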